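(* Let $\mathbf{X}\in\mathbb{R}^{n\times p}$ be a fixed matrix with $\operatorname{rank}(\mathbf{X})=p$. For every $\lambda\ge 0$, the lasso fit $\mathbf{y}\mapsto\hat{\boldsymbol{\mu}}_\lambda(\mathbf{y})$ is a uniformly Lipschitz function on $\mathbb{R}^n$. Moreover, if $\mathbf{y}\sim N(\boldsymbol{\mu},\sigma^2\mathbf{I}_n)$ with $\boldsymbol{\mu}\in\mathbb{R}^n$ and $\sigma^2>0$, then the degrees of freedom $df(\lambda)$ of the lasso fit $\hat{\boldsymbol{\mu}}_\lambda(\mathbf{y})$ equal the expected size of the active set: $$df(\lambda)=E\,|\mathcal{B}_\lambda(\mathbf{y})|.$$
   Context: For $\mathbf{y}\in\mathbb{R}^n$ and $\lambda\ge 0$, the lasso estimate is the (unique, since $\mathbf{X}$ has full column rank) minimizer $$\hat\beta(\lambda)=\hat\beta_\lambda(\mathbf{y})=\arg\min_{\beta\in\mathbb{R}^p}\ \|\mathbf{y}-\mathbf{X}\beta\|^2+\lambda\sum_{j=1}^p|\beta_j|,$$ where $\|\cdot\|$ is the Euclidean norm. The lasso fit is $\hat{\boldsymbol{\mu}}_\lambda(\mathbf{y})=\mathbf{X}\hat\beta_\lambda(\mathbf{y})$. The active set (also called effective set) is $\mathcal{B}_\lambda(\mathbf{y})=\{j\in\{1,\dots,p\}:\hat\beta_\lambda(\mathbf{y})_j\neq 0\}$, with cardinality $|\mathcal{B}_\lambda(\mathbf{y})|$. The degrees of freedom of the fit are $df(\lambda)=\sum_{i=1}^n\operatorname{cov}(\hat{\mu}_{\lambda,i}(\mathbf{y}),y_i)/\sigma^2$,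 where $\hat\mu_{\lambda,i}$ is the $i$th component of $\hat{\boldsymbol{\mu}}_\lambda$. A map $g:\mathbb{R}^n\to\mathbb{R}^n$ is uniformly Lipschitz if there is a constant $L$ with $\|g(\mathbf{y})-g(\mathbf{y}')\|\le L\|\mathbf{y}-\mathbf{y}'\|$ for all $\mathbf{y},\mathbf{y}'\in\mathbb{R}^n$. *)

theory Defs
  imports "HOL-Probability.Probability"
begin

definition lasso_objective :: "real^'p^'n \<Rightarrow> real \<Rightarrow> real^'n \<Rightarrow> real^'p \<Rightarrow> real" where
  "lasso_objective X lam y b = (norm (y - X *v b))\<^sup>2 + lam * (\<Sum>j\<in>UNIV. \<bar>b $ j\<bar>)"

(* arg_min selects some minimizer; the minimizer is unique when X has full column rank
   and lam is nonnegative. *)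
definition lasso :: "real^'p^'n \<Rightarrow> real \<Rightarrow> real^'n \<Rightarrow> real^'p" where
  "lasso X lam y = (ARG_MIN (lasso_objective X lam y) b. True)"

definition lasso_fit :: "real^'p^'n \<Rightarrow> real \<Rightarrow> real^'n \<Rightarrow> real^'n" where
  "lasso_fit X lam y = X *v lasso X lam y"

definition active_set :: "real^'p^'n \<Rightarrow> real \<Rightarrow> real^'n \<Rightarrow> 'p set" where
  "active_set X lam y = {j. lasso X lam y $ j \<noteq> 0}"

(* Lebesgue density of N(mu, sigma^2 I_n); as in normal_density, the second
   parameter is the standard deviation. *)
definition isotropic_normal_density :: "real^'n \<Rightarrow> real \<Rightarrow> real^'n \<Rightarrow> real" where
  "isotropic_normal_density \<mu> \<sigma> y =
     1 / sqrt (2 * pi * \<sigma>\<^sup>2) ^ CARD('n) * exp (- (norm (y - \<mu>))\<^sup>2 / (2 * \<sigma>\<^sup>2))"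

lemma isotropic_normal_density_eq_prod:
  "isotropic_normal_density \<mu> \<sigma> y = (\<Prod>i\<in>UNIV. normal_density (\<mu> $ i) \<sigma> (y $ i))"
proof -
  have "(\<Prod>i\<in>UNIV. normal_density (\<mu> $ i) \<sigma> (y $ i)) =
      (\<Prod>i\<in>(UNIV::'a set). 1 / sqrt (2 * pi * \<sigma>\<^sup>2)) *
      exp (\<Sum>i\<in>UNIV. - (y $ i - \<mu> $ i)\<^sup>2 / (2 * \<sigma>\<^sup>2))"
    by (simp only: normal_density_def prod.distrib exp_sum[OF finite])
  also have "(\<Sum>i\<in>UNIV. - (y $ i - \<mu> $ i)\<^sup>2 / (2 * \<sigma>\<^sup>2)) = - (norm (y - \<mu>))\<^sup>2 / (2 * \<sigma>\<^sup>2)"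
    by (simp add: norm_vec_def L2_set_def sum_nonneg sum_negf sum_divide_distrib)
  finally show ?thesis
    by (simp add: isotropic_normal_density_def power_one_over)
qed

(* The Bochner integral of a non-integrable function is 0, so the covariance is only
   meaningful together with has_covariance. *)
definition has_covariance :: "'a measure \<Rightarrow> ('a \<Rightarrow> real) \<Rightarrow> ('a \<Rightarrow> real) \<Rightarrow> bool" where
  "has_covariance M U V \<longleftrightarrow>
     integrable M U \<and> integrable M V \<and> integrable M (\<lambda>\<omega>. U \<omega> * V \<omega>)"

definition covariance :: "'a measure \<Rightarrow> ('a \<Rightarrow> real) \<Rightarrow> ('a \<Rightarrow> real) \<Rightarrow> real" where
  "covariance M U V =
     prob_space.expectation M (\<lambda>\<omega>. (U \<omega> - prob_space.expectation M U) *
                                    (V \<omega> - prob_space.expectation M V))"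

definition degrees_of_freedom ::
  "'a measure \<Rightarrow> ('a \<Rightarrow> real^'n) \<Rightarrow> real \<Rightarrow> (real^'n \<Rightarrow> real^'n) \<Rightarrow> real" where
  "degrees_of_freedom M Y \<sigma> fit =
     (\<Sum>i\<in>UNIV. covariance M (\<lambda>\<omega>. fit (Y \<omega>) $ i) (\<lambda>\<omega>. Y \<omega> $ i) / \<sigma>\<^sup>2)"

end

theory Submission
  imports Defs
begin

text \<open>
  The map \<open>y \<mapsto> X b(y)\<close> is nonexpansive because adding the first-order variational inequalities
  of two lasso problems cancels the penalty. The coordinatewise optimality conditions show that, for
  each of the finitely many sign vectors, the set of responses whose lasso solution has these signs is
  convex; its frontier is therefore negligible, and almost every response has a neighbourhood on which
  the signs are constant. On such a neighbourhood the increments of the fit are the orthogonal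
  projections of the increments of the response onto the span of the active columns, whose trace is the
  number of active columns. So the divergence of the fit is almost everywhere the size of the active set.

  Stein's identity for a Lipschitz map needs neither Rademacher's theorem nor integration by parts
  here: the Gaussian expectation of a difference quotient of the map can be rewritten, by translation
  invariance of Lebesgue measure, as an integral against a difference quotient of the density, and
  dominated convergence applies to both sides.
\<close>

section \<open>Optimality conditions for the lasso\<close>

text \<open>This is the subgradient condition for the l1 penalty: twice the correlation of column j
  with the residual equals \<open>lam * sgn (b $ j)\<close> if \<open>b $ j\<close> is nonzero, and
  has modulus at most \<open>lam\<close> otherwise. Writing the first case as a product with
  \<open>b $ j\<close> avoids a case distinction on signs.\<close>

definition lasso_kkt :: "real^'p^'n \<Rightarrow> real \<Rightarrow> real^'n \<Rightarrow> real^'p \<Rightarrow> bool" where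
  "lasso_kkt X lam y b \<longleftrightarrow>
     (\<forall>j. \<bar>2 * ((y - X *v b) v* X) $ j\<bar> \<le> lam \<and>
          2 * ((y - X *v b) v* X) $ j * b $ j = lam * \<bar>b $ j\<bar>)"

text \<open>The loss is quadratic, so its expansion around \<open>b\<close> stops at second order.
  Both directions of the optimality criterion start from this formula.\<close>

lemma lasso_objective_add:
  "lasso_objective X lam y (b + d) =
     lasso_objective X lam y b + (norm (X *v d))\<^sup>2
       - 2 * (((y - X *v b) v* X) \<bullet> d) + lam * (\<Sum>j\<in>UNIV. \<bar>(b + d) $ j\<bar> - \<bar>b $ j\<bar>)"
proof -
  have "y - X *v (b + d) = (y - X *v b) - X *v d"
    by (simp add: matrix_vector_right_distrib)
  then have "(norm (y - X *v (b + d)))\<^sup>2 =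
      (norm (y - X *v b))\<^sup>2 + (norm (X *v d))\<^sup>2 - 2 * ((y - X *v b) \<bullet> (X *v d))"
    by (simp only: power2_norm_eq_inner inner_diff_left inner_diff_right inner_commute)
       (simp add: inner_commute algebra_simps)
  then show ?thesis
    by (simp add: lasso_objective_def dot_lmul_matrix sum_subtractf algebra_simps)
qed

text \<open>The condition makes the linear term of the expansion at most the increment of the
  penalty, so the objective grows by at least \<open>(norm (X *v d))\<^sup>2\<close>, which is
  positive by injectivity.\<close>

lemma lasso_objective_strict_min:
  assumes "inj ((*v) X)" "lasso_kkt X lam y b" "c \<noteq> b"
  shows "lasso_objective X lam y b < lasso_objective X lam y c"
proof -
  define d where "d = c - b"
  let ?g = "\<lambda>j. 2 * ((y - X *v b) v* X) $ j"
  have c: "c = b + d" by (simp add: d_def)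
  have "X *v d \<noteq> 0"
    using assms(1,3) unfolding d_def
    by (metis (no_types) eq_iff_diff_eq_0 injD matrix_vector_mult_diff_distrib)
  moreover have "2 * (((y - X *v b) v* X) \<bullet> d) \<le> lam * (\<Sum>j\<in>UNIV. \<bar>(b + d) $ j\<bar> - \<bar>b $ j\<bar>)"
  proof -
    \<comment> \<open>The bound \<open>\<bar>?g j\<bar> \<le> lam\<close> handles the coordinate of
      \<open>b + d\<close>; subtracting the equality at \<open>b $ j\<close> leaves the increment
      \<open>d $ j\<close>.\<close>
    have "?g j * d $ j \<le> lam * (\<bar>(b + d) $ j\<bar> - \<bar>b $ j\<bar>)" for j
    proof -
      have "\<bar>?g j\<bar> \<le> lam" and eq: "?g j * b $ j = lam * \<bar>b $ j\<bar>"
        using assms(2) by (auto simp: lasso_kkt_def)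
      then have "?g j * (b + d) $ j \<le> lam * \<bar>(b + d) $ j\<bar>"
        using abs_ge_self[of "?g j * (b + d) $ j"] mult_right_mono[of "\<bar>?g j\<bar>" lam "\<bar>(b + d) $ j\<bar>"]
        unfolding abs_mult by linarith
      with eq show ?thesis by (simp add: algebra_simps)
    qed
    then have "(\<Sum>j\<in>UNIV. ?g j * d $ j) \<le> (\<Sum>j\<in>UNIV. lam * (\<bar>(b + d) $ j\<bar> - \<bar>b $ j\<bar>))"
      by (intro sum_mono)
    then show ?thesis
      by (simp add: inner_vec_def sum_distrib_left mult.assoc)
  qed
  ultimately show ?thesis
    unfolding c lasso_objective_add by (smt (verit) zero_less_norm_iff zero_less_power)
qed

text \<open>Compare \<open>b\<close> with \<open>b + t *\<^sub>R (c - b)\<close>. By convexity the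
  penalty grows by at most \<open>t\<close> times its full increment, while the quadratic term is of
  order \<open>t\<^sup>2\<close>. Dividing by \<open>t\<close> and letting \<open>t\<close> decrease
  to 0 removes the latter.\<close>

lemma lasso_variational:
  assumes "lam \<ge> 0" and min: "\<And>c. lasso_objective X lam y b \<le> lasso_objective X lam y c"
  shows "2 * (((y - X *v b) v* X) \<bullet> (c - b)) \<le> lam * (\<Sum>j\<in>UNIV. \<bar>c $ j\<bar> - \<bar>b $ j\<bar>)"
proof -
  define d where "d = c - b"
  let ?s = "(\<Sum>j\<in>UNIV. \<bar>c $ j\<bar> - \<bar>b $ j\<bar>)" and ?q = "2 * (((y - X *v b) v* X) \<bullet> d)"
  have *: "?q \<le> lam * ?s + t * (norm (X *v d))\<^sup>2" if t: "0 < t" "t < 1" for t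
  proof -
    have "\<bar>(b + t *\<^sub>R d) $ j\<bar> - \<bar>b $ j\<bar> \<le> t * (\<bar>c $ j\<bar> - \<bar>b $ j\<bar>)" for j
    proof -
      have "(b + t *\<^sub>R d) $ j = (1 - t) * b $ j + t * c $ j"
        by (simp add: d_def algebra_simps)
      then have "\<bar>(b + t *\<^sub>R d) $ j\<bar> \<le> (1 - t) * \<bar>b $ j\<bar> + t * \<bar>c $ j\<bar>"
        using t by (metis abs_triangle_ineq abs_mult abs_of_pos diff_gt_0_iff_gt)
      then show ?thesis by (simp add: algebra_simps)
    qed
    then have "(\<Sum>j\<in>UNIV. \<bar>(b + t *\<^sub>R d) $ j\<bar> - \<bar>b $ j\<bar>) \<le> t * ?s"
      by (simp only: sum_distrib_left sum_mono)
    then have le: "lam * (\<Sum>j\<in>UNIV. \<bar>(b + t *\<^sub>R d) $ j\<bar> - \<bar>b $ j\<bar>) \<le> t * (lam * ?s)"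
      using mult_left_mono[OF _ assms(1)] by (metis mult.left_commute)
    have "0 \<le> (norm (X *v (t *\<^sub>R d)))\<^sup>2 - 2 * (((y - X *v b) v* X) \<bullet> (t *\<^sub>R d))
               + lam * (\<Sum>j\<in>UNIV. \<bar>(b + t *\<^sub>R d) $ j\<bar> - \<bar>b $ j\<bar>)"
      using min[of "b + t *\<^sub>R d"] unfolding lasso_objective_add by linarith
    with le have "t * ?q \<le> t * (lam * ?s + t * (norm (X *v d))\<^sup>2)"
      by (simp add: matrix_vector_mult_scaleR power_mult_distrib algebra_simps power2_eq_square)
    then show ?thesis using t by simp
  qed
  have "((\<lambda>t. lam * ?s + t * (norm (X *v d))\<^sup>2) \<longlongrightarrow> lam * ?s + 0 * (norm (X *v d))\<^sup>2) (at_right 0)"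
    by (intro tendsto_intros)
  moreover have "\<forall>\<^sub>F t in at_right 0. ?q \<le> lam * ?s + t * (norm (X *v d))\<^sup>2"
    using eventually_at_right_real[of 0 "1::real"] by (auto elim!: eventually_mono intro!: *)
  ultimately have "?q \<le> lam * ?s + 0 * (norm (X *v d))\<^sup>2"
    by (intro tendsto_lowerbound[OF _ _ trivial_limit_at_right_real])
  then show ?thesis by (simp add: d_def)
qed

text \<open>The variational inequality is tested along the coordinate axes.\<close>

lemma minimizer_imp_lasso_kkt:
  assumes "lam \<ge> 0" and min: "\<And>c. lasso_objective X lam y b \<le> lasso_objective X lam y c"
  shows "lasso_kkt X lam y b"
  unfolding lasso_kkt_def
proof (intro allI conjI)
  fix j
  let ?g = "(y - X *v b) v* X"
  have coord: "2 * ?g $ j * s \<le> lam * (\<bar>b $ j + s\<bar> - \<bar>b $ j\<bar>)" for s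
  proof -
    have "(\<Sum>k\<in>UNIV. \<bar>(b + axis j s) $ k\<bar> - \<bar>b $ k\<bar>) = \<bar>b $ j + s\<bar> - \<bar>b $ j\<bar>"
      by (subst sum.remove[of _ j]) (auto simp: axis_def)
    with lasso_variational[OF assms, of "b + axis j s"] show ?thesis
      by (simp add: inner_axis)
  qed
  have "2 * ?g $ j * s \<le> lam * \<bar>s\<bar>" for s
    using coord[of s] mult_left_mono[OF _ assms(1), of "\<bar>b $ j + s\<bar> - \<bar>b $ j\<bar>" "\<bar>s\<bar>"] by fastforce
  from this[of 1] this[of "-1"] show "\<bar>2 * ?g $ j\<bar> \<le> lam" by simp
  \<comment> \<open>Doubling the coordinate gives one inequality, deleting it gives the reverse
    one.\<close>
  show "2 * ?g $ j * b $ j = lam * \<bar>b $ j\<bar>"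
    using coord[of "b $ j"] coord[of "- b $ j"] by (simp add: abs_mult)
qed

text \<open>An injective \<open>X\<close> is bounded below by some \<open>B > 0\<close>. Beyond the
  radius \<open>R\<close> the loss alone is at least \<open>(norm y)\<^sup>2\<close>, the objective
  at 0, so a minimizer over the compact ball is global.\<close>

lemma lasso_objective_attains_min:
  assumes "inj ((*v) X)" "lam \<ge> 0"
  obtains b where "\<And>c. lasso_objective X lam y b \<le> lasso_objective X lam y c"
proof -
  obtain B where B: "B > 0" "\<And>b. B * norm b \<le> norm (X *v b)"
    using linear_inj_bounded_below_pos[OF matrix_vector_mul_linear assms(1)] by metis
  define R where "R = 2 * norm y / B"
  have R: "R \<ge> 0" using B by (simp add: R_def)
  have "continuous_on (cball 0 R) (lasso_objective X lam y)"
    unfolding lasso_objective_def by (intro continuous_intros linear_continuous_on matrix_vector_mul_bounded_linear)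
  then obtain b where b: "\<forall>c\<in>cball 0 R. lasso_objective X lam y b \<le> lasso_objective X lam y c"
    using continuous_attains_inf[of "cball 0 R" "lasso_objective X lam y"] R by fastforce
  have "lasso_objective X lam y b \<le> lasso_objective X lam y c" for c
  proof (cases "norm c \<le> R")
    case True
    with b show ?thesis by simp
  next
    case False
    have "lasso_objective X lam y b \<le> lasso_objective X lam y 0" using b R by simp
    also have "\<dots> = (norm y)\<^sup>2" by (simp add: lasso_objective_def)
    also have "\<dots> \<le> (norm (y - X *v c))\<^sup>2"
    proof (intro power_mono norm_ge_zero)
      have "2 * norm y \<le> B * norm c" using False B(1) by (simp add: R_def field_simps)
      with B(2)[of c] norm_triangle_sub[of "X *v c" y] show "norm y \<le> norm (y - X *v c)"
        by (simp add: norm_minus_commute)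
    qed
    also have "\<dots> \<le> lasso_objective X lam y c"
      using assms(2) by (simp add: lasso_objective_def sum_nonneg)
    finally show ?thesis .
  qed
  then show thesis using that by blast
qed

lemma lasso_kkt_iff:
  assumes "inj ((*v) X)" "lam \<ge> 0"
  shows "lasso_kkt X lam y b \<longleftrightarrow> b = lasso X lam y"
proof -
  obtain b0 where "\<And>c. lasso_objective X lam y b0 \<le> lasso_objective X lam y c"
    using lasso_objective_attains_min[OF assms] by blast
  then have b0: "lasso_kkt X lam y b0"
    using minimizer_imp_lasso_kkt assms(2) by blast
  \<comment> \<open>Strict minimality leaves the choice operator behind \<open>ARG_MIN\<close> a
    single candidate.\<close>
  have *: "c = lasso X lam y" if "lasso_kkt X lam y c" for c
    using lasso_objective_strict_min[OF assms(1) that]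
    unfolding lasso_def arg_min_def is_arg_min_def
    by (intro some_equality[symmetric]) (metis less_asym less_irrefl)+
  with b0 show ?thesis by metis
qed

text \<open>Each solution is used as competitor in the other problem. The sum of the two
  inequalities is firm nonexpansiveness, and Cauchy-Schwarz turns it into the constant 1, whatever
  \<open>X\<close> and \<open>lam\<close> are.\<close>

lemma lasso_fit_lipschitz:
  fixes X :: "real^'p^'n"
  assumes "inj ((*v) X)" "lam \<ge> 0"
  shows "1-lipschitz_on UNIV (lasso_fit X lam)"
proof (rule lipschitz_onI)
  fix y y' :: "real^'n"
  let ?b = "lasso X lam y" and ?b' = "lasso X lam y'"
  let ?u = "lasso_fit X lam y" and ?u' = "lasso_fit X lam y'"
  have min: "lasso_objective X lam z (lasso X lam z) \<le> lasso_objective X lam z c" for z c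
    using lasso_objective_strict_min[OF assms(1)] lasso_kkt_iff[OF assms] by (metis less_imp_le order_refl)
  have "2 * ((y - ?u) \<bullet> (?u' - ?u)) \<le> lam * (\<Sum>j\<in>UNIV. \<bar>?b' $ j\<bar> - \<bar>?b $ j\<bar>)"
    using lasso_variational[OF assms(2) min, of y ?b']
    by (simp add: dot_lmul_matrix lasso_fit_def matrix_vector_mult_diff_distrib)
  moreover have "2 * ((y' - ?u') \<bullet> (?u - ?u')) \<le> lam * (\<Sum>j\<in>UNIV. \<bar>?b $ j\<bar> - \<bar>?b' $ j\<bar>)"
    using lasso_variational[OF assms(2) min, of y' ?b]
    by (simp add: dot_lmul_matrix lasso_fit_def matrix_vector_mult_diff_distrib)
  ultimately have "(y - ?u) \<bullet> (?u' - ?u) + (y' - ?u') \<bullet> (?u - ?u') \<le> 0"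
    by (simp add: sum_subtractf algebra_simps)
  then have "(norm (?u - ?u'))\<^sup>2 \<le> (y - y') \<bullet> (?u - ?u')"
    by (simp add: power2_norm_eq_inner inner_diff_left inner_diff_right inner_commute)
  also have "\<dots> \<le> norm (y - y') * norm (?u - ?u')" by (rule norm_cauchy_schwarz)
  finally show "dist ?u ?u' \<le> 1 * dist y y'"
    by (cases "?u = ?u'") (auto simp: dist_norm power2_eq_square)
qed simp

text \<open>A left inverse of \<open>X\<close> recovers the coefficients from the fit, which is
  already known to be Lipschitz.\<close>

lemma lasso_continuous:
  fixes X :: "real^'p^'n"
  assumes "inj ((*v) X)" "lam \<ge> 0"
  shows "continuous_on UNIV (lasso X lam)"
proof -
  obtain Z where Z: "Z ** X = mat 1" using assms(1) matrix_left_invertible_injective by metis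
  then have "lasso X lam = (\<lambda>y. Z *v lasso_fit X lam y)"
    by (auto simp: lasso_fit_def matrix_vector_mul_assoc)
  moreover have "continuous_on UNIV (\<lambda>y. Z *v lasso_fit X lam y)"
    by (intro matrix_vector_mult_linear_continuous_on[THEN continuous_on_compose2, of UNIV]
        lipschitz_on_continuous_on[OF lasso_fit_lipschitz[OF assms]]) auto
  ultimately show ?thesis by simp
qed

section \<open>Divergence of the lasso fit\<close>

text \<open>Once the signs are fixed, the optimality conditions are linear equations and convex
  bounds in the pair of response and coefficients. Hence the same convex combination of two
  solutions solves the combined problem.\<close>

lemma convex_lasso_sign_pattern:
  fixes X :: "real^'p^'n"
  assumes "inj ((*v) X)" "lam \<ge> 0"
  shows "convex {y. \<forall>j. sgn (lasso X lam y $ j) = s j}"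
proof (rule convexI)
  fix y y' and u v :: real
  assume y: "y \<in> {y. \<forall>j. sgn (lasso X lam y $ j) = s j}" and y': "y' \<in> {y. \<forall>j. sgn (lasso X lam y $ j) = s j}"
    and uv: "0 \<le> u" "0 \<le> v" "u + v = 1"
  let ?b = "lasso X lam y" and ?b' = "lasso X lam y'"
  let ?c = "u *\<^sub>R ?b + v *\<^sub>R ?b'"
  let ?g = "\<lambda>y b j. 2 * ((y - X *v b) v* X) $ j"
  have g: "?g (u *\<^sub>R y + v *\<^sub>R y') ?c j = u * ?g y ?b j + v * ?g y' ?b' j" for j
  proof -
    have "(u *\<^sub>R y + v *\<^sub>R y') - X *v ?c = u *\<^sub>R (y - X *v ?b) + v *\<^sub>R (y' - X *v ?b')"
      by (simp add: matrix_vector_right_distrib matrix_vector_mult_scaleR algebra_simps)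
    then show ?thesis
      by (simp only:) (simp add: vector_matrix_mult_def sum.distrib[symmetric] sum_distrib_left algebra_simps)
  qed
  have k: "\<bar>?g y ?b j\<bar> \<le> lam" "?g y ?b j * ?b $ j = lam * \<bar>?b $ j\<bar>"
      "\<bar>?g y' ?b' j\<bar> \<le> lam" "?g y' ?b' j * ?b' $ j = lam * \<bar>?b' $ j\<bar>" for j
    using lasso_kkt_iff[OF assms] unfolding lasso_kkt_def by metis+
  have s: "sgn (?b $ j) = s j" "sgn (?b' $ j) = s j" for j using y y' by auto
  \<comment> \<open>With \<open>u = 0\<close> the combination is \<open>?b'\<close>; otherwise the
    first summand has the strict sign and the second cannot oppose it.\<close>
  have sc: "sgn (?c $ j) = s j" for j
  proof (cases "u = 0")
    case True
    then show ?thesis using s uv by simp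
  next
    case False
    consider "s j = 0" | "s j = 1" | "s j = -1" using s[of j] sgn_real_def by metis
    then show ?thesis
    proof cases
      case 1
      then show ?thesis using s[of j] by (simp add: sgn_zero_iff)
    next
      case 2
      then have "?b $ j > 0" "?b' $ j > 0" using s[of j] by (auto simp: sgn_1_pos)
      then have "?c $ j > 0" using False uv by (auto intro!: add_pos_nonneg mult_pos_pos)
      with 2 show ?thesis by simp
    next
      case 3
      then have "?b $ j < 0" "?b' $ j < 0" using s[of j] by (auto simp: sgn_1_neg)
      then have "?c $ j < 0" using False uv by (auto intro!: add_neg_nonpos mult_pos_neg mult_nonneg_nonpos)
      with 3 show ?thesis by simp
    qed
  qed
  \<comment> \<open>The complementarity equation is freed of the size of the coefficient, so that
    both problems satisfy it with the same \<open>s j\<close> and it can be combined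
    linearly.\<close>
  have gs: "?g y ?b j * s j = lam * \<bar>s j\<bar>" "?g y' ?b' j * s j = lam * \<bar>s j\<bar>" for j
  proof -
    have "(x::real) * a = lam * \<bar>a\<bar> \<Longrightarrow> x * sgn a = lam * \<bar>sgn a\<bar>" for x a
      by (cases "a > 0"; cases "a = 0") (auto simp: sgn_real_def, metis mult_minus_left mult_right_cancel minus_equation_iff)
    from this[OF k(2)] this[OF k(4)] s
    show "?g y ?b j * s j = lam * \<bar>s j\<bar>" "?g y' ?b' j * s j = lam * \<bar>s j\<bar>" by auto
  qed
  have "lasso_kkt X lam (u *\<^sub>R y + v *\<^sub>R y') ?c"
    unfolding lasso_kkt_def
  proof (intro allI conjI)
    fix j
    have "\<bar>u * ?g y ?b j + v * ?g y' ?b' j\<bar> \<le> u * lam + v * lam"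
      using k[of j] uv(1,2)
      by (intro order_trans[OF abs_triangle_ineq] add_mono) (simp_all add: abs_mult mult_left_mono)
    also have "\<dots> = lam" using uv(3) by (metis distrib_right mult_1)
    finally show "\<bar>?g (u *\<^sub>R y + v *\<^sub>R y') ?c j\<bar> \<le> lam" unfolding g .
    have "(u * ?g y ?b j + v * ?g y' ?b' j) * s j = u * (?g y ?b j * s j) + v * (?g y' ?b' j * s j)"
      by (simp only: algebra_simps)
    also have "\<dots> = lam * \<bar>s j\<bar>"
      unfolding gs using uv(3) by (metis distrib_right mult_1)
    finally have "(u * ?g y ?b j + v * ?g y' ?b' j) * s j * \<bar>?c $ j\<bar> = lam * (\<bar>s j\<bar> * \<bar>?c $ j\<bar>)" by simp
    moreover have "s j * \<bar>?c $ j\<bar> = ?c $ j" "\<bar>s j\<bar> * \<bar>?c $ j\<bar> = \<bar>?c $ j\<bar>"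
      unfolding sc[symmetric] by (simp_all only: sgn_mult_abs) (simp add: sgn_real_def)
    ultimately show "?g (u *\<^sub>R y + v *\<^sub>R y') ?c j * ?c $ j = lam * \<bar>?c $ j\<bar>"
      unfolding g by (simp only: mult.assoc)
  qed
  then have "lasso X lam (u *\<^sub>R y + v *\<^sub>R y') = ?c" using lasso_kkt_iff[OF assms] by metis
  with sc show "u *\<^sub>R y + v *\<^sub>R y' \<in> {y. \<forall>j. sgn (lasso X lam y $ j) = s j}" by simp
qed

text \<open>Solution signs take values in the finite set \<open>S\<close> of patterns. Off the union
  of the frontiers, each response is interior to its own pattern.\<close>

lemma AE_lasso_sign_locally_constant:
  fixes X :: "real^'p^'n"
  assumes "inj ((*v) X)" "lam \<ge> 0"
  shows "AE y in lborel. \<forall>\<^sub>F z in nhds y. \<forall>j. sgn (lasso X lam z $ j) = sgn (lasso X lam y $ j)"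
proof -
  define E where "E s = {y. \<forall>j. sgn (lasso X lam y $ j) = s $ j}" for s :: "real^'p"
  define S where "S = {s :: real^'p. \<forall>j. s $ j \<in> {-1, 0, 1}}"
  have "finite S"
  proof -
    have "S \<subseteq> vec_lambda ` (UNIV \<rightarrow>\<^sub>E {-1, 0, 1})"
      unfolding S_def by (auto intro!: image_eqI[where x="vec_nth _"])
    then show ?thesis by (rule finite_subset) (intro finite_imageI finite_PiE, auto)
  qed
  have "frontier (E s) \<in> null_sets lborel" for s
  proof -
    have "negligible (frontier (E s))"
      unfolding E_def by (intro negligible_convex_frontier convex_lasso_sign_pattern assms)
    \<comment> \<open>Negligibility refers to the completed measure; a frontier is closed, hence
      Borel, and so is null for \<open>lborel\<close> itself.\<close>
    then show ?thesis
      by (simp add: negligible_iff_null_sets null_sets_completion_iff)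
  qed
  with \<open>finite S\<close> have "(\<Union>s\<in>S. frontier (E s)) \<in> null_sets lborel"
    by (intro null_sets_UN') (auto intro: countable_finite)
  then show ?thesis
  proof (rule AE_I')
    show "{y \<in> space lborel. \<not> (\<forall>\<^sub>F z in nhds y. \<forall>j. sgn (lasso X lam z $ j) = sgn (lasso X lam y $ j))}
        \<subseteq> (\<Union>s\<in>S. frontier (E s))"
    proof (rule subsetI, rule ccontr)
      fix y
      assume y: "y \<in> {y \<in> space lborel. \<not> (\<forall>\<^sub>F z in nhds y. \<forall>j. sgn (lasso X lam z $ j) = sgn (lasso X lam y $ j))}"
        and n: "y \<notin> (\<Union>s\<in>S. frontier (E s))"
      define s where "s = (\<chi> j. sgn (lasso X lam y $ j))"
      have "s \<in> S" by (auto simp: s_def S_def sgn_real_def)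
      with n have "y \<notin> frontier (E s)" by blast
      moreover have "y \<in> E s" by (simp add: E_def s_def)
      ultimately have "y \<in> interior (E s)"
        using closure_subset by (auto simp: frontier_def)
      then have "\<forall>\<^sub>F z in nhds y. z \<in> E s"
        by (meson eventually_nhds interior_subset open_interior subsetD)
      with y show False by (auto simp: E_def s_def elim: eventually_mono)
    qed
  qed
qed

text \<open>The hypotheses say that \<open>p i\<close> is the orthogonal projection of the i-th unit
  vector onto \<open>S\<close>, so the sum is the trace of the projection. In an orthonormal basis
  of \<open>S\<close> it becomes the sum of the squared norms of the basis vectors.\<close>

lemma sum_orthogonal_projection_axis:
  fixes S :: "(real^'n) set" and p :: "'n \<Rightarrow> real^'n"
  assumes "subspace S" and p: "\<And>i. p i \<in> S" "\<And>i v. v \<in> S \<Longrightarrow> (axis i 1 - p i) \<bullet> v = 0"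
  shows "(\<Sum>i\<in>UNIV. p i $ i) = real (dim S)"
proof -
  obtain B where B: "B \<subseteq> S" "pairwise orthogonal B" "\<And>x. x \<in> B \<Longrightarrow> norm x = 1"
      "independent B" "card B = dim S" "span B = S"
    using orthonormal_basis_subspace[OF assms(1)] by metis
  have fin: "finite B" using B(4) by (rule independent_imp_finite)
  have "p i $ i = (\<Sum>u\<in>B. (u $ i)\<^sup>2)" for i
  proof -
    have "p i \<bullet> u = u $ i" if "u \<in> B" for u
      using p(2)[of u i] that B(1) by (auto simp: inner_diff_left inner_axis')
    then have "p i = (\<Sum>u\<in>B. u $ i *\<^sub>R u)"
      using orthonormal_basis_expand[OF B(2,3) _ fin, of "p i"] p(1)[of i] B(6) by simp
    then have "p i $ i = (\<Sum>u\<in>B. u $ i *\<^sub>R u) $ i" by simp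
    then show ?thesis by (simp add: power2_eq_square)
  qed
  then have "(\<Sum>i\<in>UNIV. p i $ i) = (\<Sum>u\<in>B. \<Sum>i\<in>UNIV. (u $ i)\<^sup>2)"
    by (simp add: sum.swap[of _ B])
  also have "\<dots> = (\<Sum>u\<in>B. (norm u)\<^sup>2)"
    by (simp add: norm_vec_def L2_set_def sum_nonneg)
  also have "\<dots> = real (dim S)" using B(3,5) by simp
  finally show ?thesis .
qed

text \<open>Equal signs force equal residual correlations on the active columns, so the increment of
  the residual is orthogonal to their span, while the increment of the fit lies in it. The quotients
  are therefore exact projections of the unit vectors, before any limit is taken.\<close>

lemma lasso_divergence_quotient:
  fixes X :: "real^'p^'n"
  assumes "inj ((*v) X)" "lam \<ge> 0" "t \<noteq> 0"
    and sgn: "\<And>i j. sgn (lasso X lam (y + t *\<^sub>R axis i 1) $ j) = sgn (lasso X lam y $ j)"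
  shows "(\<Sum>i\<in>UNIV. (lasso_fit X lam (y + t *\<^sub>R axis i 1) $ i - lasso_fit X lam y $ i) / t)
           = real (card (active_set X lam y))"
proof -
  let ?A = "active_set X lam y"
  \<comment> \<open>\<open>C\<close> holds the coefficient vectors supported on the active set, so
    \<open>S\<close> is the span of the active columns; injectivity preserves the dimension.\<close>
  define C where "C = {b::real^'p. \<forall>j. j \<notin> ?A \<longrightarrow> b $ j = 0}"
  define S where "S = (*v) X ` C"
  have "subspace C" by (auto simp: C_def subspace_def)
  then have S: "subspace S"
    unfolding S_def by (intro linear_subspace_image matrix_vector_mul_linear)
  have "dim S = dim C"
    unfolding S_def using assms(1)
    by (intro dim_image_eq matrix_vector_mul_linear) (auto intro: inj_on_subset)
  also have "\<dots> = card ?A"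
    using dim_substandard_cart[of ?A, where ?'a=real] by (simp add: C_def dim_vec_eq)
  finally have dim: "dim S = card ?A" .
  define p where "p i = (1/t) *\<^sub>R (lasso_fit X lam (y + t *\<^sub>R axis i 1) - lasso_fit X lam y)" for i
  have "(\<Sum>i\<in>UNIV. p i $ i) = real (dim S)"
  proof (rule sum_orthogonal_projection_axis[OF S])
    fix i
    let ?z = "y + t *\<^sub>R axis i 1"
    have az: "lasso X lam ?z $ j = 0 \<longleftrightarrow> lasso X lam y $ j = 0" for j
      using sgn by (metis sgn_zero_iff)
    have "p i = X *v ((1/t) *\<^sub>R (lasso X lam ?z - lasso X lam y))"
      by (simp add: p_def lasso_fit_def matrix_vector_mult_scaleR matrix_vector_mult_diff_distrib)
    moreover have "(1/t) *\<^sub>R (lasso X lam ?z - lasso X lam y) \<in> C"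
      using az by (auto simp: C_def active_set_def)
    ultimately show "p i \<in> S" by (simp add: S_def)
    fix v assume "v \<in> S"
    then obtain b where b: "v = X *v b" "b \<in> C" by (auto simp: S_def)
    let ?g = "\<lambda>y. ((y - lasso_fit X lam y) v* X)"
    have k: "2 * ?g w $ j * lasso X lam w $ j = lam * \<bar>lasso X lam w $ j\<bar>" for w j
      using lasso_kkt_iff[OF assms(1,2)] unfolding lasso_kkt_def lasso_fit_def by metis
    have g: "?g ?z $ j = ?g y $ j" if "j \<in> ?A" for j
    proof -
      have nz: "lasso X lam y $ j \<noteq> 0" using that by (simp add: active_set_def)
      have "2 * ?g w $ j = lam * sgn (lasso X lam w $ j)" if "lasso X lam w $ j \<noteq> 0" for w
      proof -
        have "2 * ?g w $ j * lasso X lam w $ j = lam * sgn (lasso X lam w $ j) * lasso X lam w $ j"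
          using k[of w j] by (simp add: abs_sgn mult.assoc mult.commute)
        with that show ?thesis by (metis mult_right_cancel)
      qed
      from this[of y] this[of ?z] nz az sgn show ?thesis by simp
    qed
    have "(?g ?z - ?g y) \<bullet> b = 0"
      unfolding inner_vec_def using b(2) g by (intro sum.neutral ballI) (metis (mono_tags, lifting) C_def cancel_comm_monoid_add_class.diff_cancel inner_zero_left inner_zero_right mem_Collect_eq vector_minus_component)
    then have "(?z - lasso_fit X lam ?z - (y - lasso_fit X lam y)) \<bullet> v = 0"
      by (simp only: dot_lmul_matrix inner_diff_left b(1))
    \<comment> \<open>The response moves by \<open>t *\<^sub>R axis i 1\<close>, so this difference
      is the increment of the residual divided by \<open>t\<close>.\<close>
    moreover have "axis i 1 - p i = (1/t) *\<^sub>R (?z - lasso_fit X lam ?z - (y - lasso_fit X lam y))"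
      using assms(3) by (simp add: p_def algebra_simps)
    ultimately show "(axis i 1 - p i) \<bullet> v = 0" by (metis inner_scaleR_left mult_zero_right)
  qed
  with dim show ?thesis by (simp add: p_def)
qed

lemma AE_lasso_divergence:
  fixes X :: "real^'p^'n"
  assumes "inj ((*v) X)" "lam \<ge> 0" and h: "h \<longlonglongrightarrow> 0" "\<And>n. h n \<noteq> 0"
  shows "AE y in lborel.
    (\<lambda>n. \<Sum>i\<in>UNIV. (lasso_fit X lam (y + h n *\<^sub>R axis i 1) $ i - lasso_fit X lam y $ i) / h n)
      \<longlonglongrightarrow> real (card (active_set X lam y))"
  using AE_lasso_sign_locally_constant[OF assms(1,2)]
proof eventually_elim
  case (elim y)
  have "(\<lambda>n. y + h n *\<^sub>R axis i 1) \<longlonglongrightarrow> y" for i :: 'n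
    using tendsto_add[OF tendsto_const tendsto_scaleR[OF h(1) tendsto_const]] by fastforce
  \<comment> \<open>Finitely many directions share one threshold, beyond which the quotient sum is
    constant.\<close>
  then have "\<forall>\<^sub>F n in sequentially. \<forall>i. \<forall>j. sgn (lasso X lam (y + h n *\<^sub>R axis i 1) $ j) = sgn (lasso X lam y $ j)"
    by - (rule eventually_all_finite, rule eventually_compose_filterlim[OF elim])
  then show ?case
    by (intro tendsto_eventually) (auto elim!: eventually_mono intro!: lasso_divergence_quotient assms)
qed

section \<open>Stein's identity for Lipschitz maps\<close>

lemma borel_measurable_vec_nth [measurable (raw)]:
  fixes f :: "'a \<Rightarrow> real^'n"
  assumes "f \<in> borel_measurable M"
  shows "(\<lambda>x. f x $ i) \<in> borel_measurable M"
  by (rule borel_measurable_continuous_on[OF _ assms]) (intro continuous_intros)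

text \<open>The kernel is a product over the coordinates. The standard deviation \<open>s\<close> is
  chosen so that each factor is a multiple of a normal density.\<close>

lemma integrable_exp_neg_norm_square:
  fixes m :: "'a::euclidean_space"
  assumes "c > 0"
  shows "integrable lborel (\<lambda>x. exp (- c * (norm (x - m))\<^sup>2))"
proof (rule integrableI_nonneg)
  define s where "s = sqrt (1 / (2 * c))"
  have s: "s > 0" "s\<^sup>2 = 1 / (2 * c)" using assms by (auto simp: s_def)
  have e: "exp (- c * (x - a)\<^sup>2) = sqrt (2 * pi * s\<^sup>2) * normal_density a s x" for x a :: real
    using s assms by (simp add: normal_density_def field_simps)
  have fin: "(\<integral>\<^sup>+x. ennreal (exp (- c * (x - a)\<^sup>2)) \<partial>lborel) < \<infinity>" for a :: real
  proof -
    have "integrable lborel (\<lambda>x. exp (- c * (x - a)\<^sup>2))"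
      unfolding e using s by (intro integrable_mult_right integrable_normal_density)
    then show ?thesis by (simp add: integrable_iff_bounded)
  qed
  have "(\<integral>\<^sup>+x. ennreal (exp (- c * (norm (x - m))\<^sup>2)) \<partial>lborel)
      = (\<integral>\<^sup>+x. (\<Prod>b\<in>Basis. ennreal (exp (- c * (x \<bullet> b - m \<bullet> b)\<^sup>2))) \<partial>lborel)"
  proof (rule nn_integral_cong)
    fix x :: 'a
    have "(norm (x - m))\<^sup>2 = (\<Sum>b\<in>Basis. (x \<bullet> b - m \<bullet> b)\<^sup>2)"
      unfolding power2_norm_eq_inner euclidean_inner[of "x - m" "x - m"]
      by (simp add: inner_diff_left power2_eq_square)
    then show "ennreal (exp (- c * (norm (x - m))\<^sup>2)) = (\<Prod>b\<in>Basis. ennreal (exp (- c * (x \<bullet> b - m \<bullet> b)\<^sup>2)))"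
      by (simp add: sum_distrib_left exp_sum prod_ennreal)
  qed
  also have "\<dots> = (\<Prod>b\<in>Basis. \<integral>\<^sup>+x. ennreal (exp (- c * (x - m \<bullet> b)\<^sup>2)) \<partial>lborel)"
    by (rule nn_integral_lborel_prod) auto
  also have "\<dots> < \<infinity>"
    using fin by (simp add: less_top[symmetric] ennreal_prod_eq_top)
  finally show "(\<integral>\<^sup>+x. ennreal (exp (- c * (norm (x - m))\<^sup>2)) \<partial>lborel) < \<infinity>" .
qed auto

text \<open>Half of the exponential decay absorbs the polynomial. The factor
  \<open>2 + 4 / c\<close> comes from \<open>(1 + u)\<^sup>2 \<le> 2 + 2 * u\<^sup>2\<close> and
  \<open>u\<^sup>2 \<le> 2 / c * exp (c / 2 * u\<^sup>2)\<close>.\<close>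

lemma integrable_square_exp_neg_norm_square:
  fixes m :: "'a::euclidean_space"
  assumes c: "c > 0"
  shows "integrable lborel (\<lambda>x. (1 + norm (x - m))\<^sup>2 * exp (- c * (norm (x - m))\<^sup>2))"
proof (rule Bochner_Integration.integrable_bound)
  show "integrable lborel (\<lambda>x. (2 + 4 / c) * exp (- (c / 2) * (norm (x - m))\<^sup>2))"
    using c by (intro integrable_mult_right integrable_exp_neg_norm_square) simp
  show "AE x in lborel. norm ((1 + norm (x - m))\<^sup>2 * exp (- c * (norm (x - m))\<^sup>2))
      \<le> norm ((2 + 4 / c) * exp (- (c / 2) * (norm (x - m))\<^sup>2))"
  proof (rule AE_I2)
    fix x
    define u where "u = norm (x - m)"
    have "c / 2 * u\<^sup>2 \<le> exp (c / 2 * u\<^sup>2)" and "1 \<le> exp (c / 2 * u\<^sup>2)"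
      using c exp_ge_add_one_self[of "c / 2 * u\<^sup>2"] by (simp_all del: exp_ge_add_one_self)
    then have "u\<^sup>2 \<le> 2 * (exp (c / 2 * u\<^sup>2) / c)" and E1: "1 \<le> exp (c / 2 * u\<^sup>2)"
      using c by (simp_all add: field_simps)
    moreover have "(1 + u)\<^sup>2 \<le> 2 + 2 * u\<^sup>2"
      using zero_le_power2[of "1 - u"] by (simp add: power2_eq_square algebra_simps)
    ultimately have "(1 + u)\<^sup>2 \<le> 2 * exp (c / 2 * u\<^sup>2) + 4 * (exp (c / 2 * u\<^sup>2) / c)"
      using E1 by linarith
    then have "(1 + u)\<^sup>2 \<le> (2 + 4 / c) * exp (c / 2 * u\<^sup>2)"
      by (simp add: distrib_right)
    then have "(1 + u)\<^sup>2 * exp (- c * u\<^sup>2) \<le> (2 + 4 / c) * exp (c / 2 * u\<^sup>2) * exp (- c * u\<^sup>2)"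
      by (rule mult_right_mono) simp
    also have "\<dots> = (2 + 4 / c) * exp (- (c / 2) * u\<^sup>2)"
      unfolding mult.assoc exp_add[symmetric] by (simp add: field_simps)
    finally show "norm ((1 + norm (x - m))\<^sup>2 * exp (- c * (norm (x - m))\<^sup>2))
      \<le> norm ((2 + 4 / c) * exp (- (c / 2) * (norm (x - m))\<^sup>2))"
      using c by (simp add: u_def)
  qed
qed measurable

lemma integrable_gaussian_bound:
  fixes m :: "'a::euclidean_space" and g :: "'a \<Rightarrow> real"
  assumes "c > 0" "g \<in> borel_measurable lborel"
    and "\<And>x. \<bar>g x\<bar> \<le> K * ((1 + norm (x - m))\<^sup>2 * exp (- c * (norm (x - m))\<^sup>2))"
  shows "integrable lborel g"
proof (rule Bochner_Integration.integrable_bound)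
  show "integrable lborel (\<lambda>x. K * ((1 + norm (x - m))\<^sup>2 * exp (- c * (norm (x - m))\<^sup>2)))"
    by (intro integrable_mult_right integrable_square_exp_neg_norm_square assms)
  show "AE x in lborel. norm (g x) \<le> norm (K * ((1 + norm (x - m))\<^sup>2 * exp (- c * (norm (x - m))\<^sup>2)))"
    using assms(3) by (intro AE_I2) (metis abs_ge_self order_trans real_norm_def)
qed fact

section \<open>Translates of the normal density\<close>

lemma isotropic_normal_density_nonneg: "0 \<le> isotropic_normal_density m s y"
  by (simp add: isotropic_normal_density_def)

lemma isotropic_normal_density_measurable [measurable]:
  "isotropic_normal_density m s \<in> borel_measurable borel"
  unfolding isotropic_normal_density_def by measurable

text \<open>Expanding the square turns a shift into an exponential factor. Difference quotients of
  the density thus reduce to those of a scalar exponential.\<close>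

lemma isotropic_normal_density_translate:
  fixes m :: "real^'n"
  assumes "s \<noteq> 0"
  shows "isotropic_normal_density m s (z - t *\<^sub>R axis i 1) =
    isotropic_normal_density m s z * exp ((t * (z $ i - m $ i) - t\<^sup>2 / 2) / s\<^sup>2)"
proof -
  have *: "z - t *\<^sub>R axis i 1 - m = (z - m) - t *\<^sub>R axis i 1" by simp
  have "(norm (z - t *\<^sub>R axis i 1 - m))\<^sup>2 = (norm (z - m))\<^sup>2 - 2 * t * (z $ i - m $ i) + t\<^sup>2"
    unfolding * power2_norm_eq_inner inner_diff_left[of "z - m"] inner_diff_right
    by (simp add: inner_axis inner_axis' power2_eq_square algebra_simps)
  then have eq: "- (norm (z - t *\<^sub>R axis i 1 - m))\<^sup>2 / (2 * s\<^sup>2) =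
      - (norm (z - m))\<^sup>2 / (2 * s\<^sup>2) + (t * (z $ i - m $ i) - t\<^sup>2 / 2) / s\<^sup>2"
    using assms by (simp only:) (simp add: divide_simps algebra_simps)
  show ?thesis
    unfolding isotropic_normal_density_def eq by (simp only: exp_add mult.assoc)
qed

lemma isotropic_normal_density_difference_quotient_tendsto:
  fixes m :: "real^'n"
  assumes "s \<noteq> 0" and h: "h \<longlonglongrightarrow> 0" "\<And>n. h n \<noteq> 0"
  shows "(\<lambda>n. (isotropic_normal_density m s (z - h n *\<^sub>R axis i 1) - isotropic_normal_density m s z) / h n)
    \<longlonglongrightarrow> isotropic_normal_density m s z * (z $ i - m $ i) / s\<^sup>2"
proof -
  let ?w = "z $ i - m $ i"
  have "((\<lambda>t. exp ((t * ?w - t\<^sup>2 / 2) / s\<^sup>2)) has_real_derivative ?w / s\<^sup>2) (at 0)"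
    using assms(1) by (auto intro!: derivative_eq_intros simp: power2_eq_square)
  then have "((\<lambda>t. (exp ((t * ?w - t\<^sup>2 / 2) / s\<^sup>2) - 1) / t) \<longlongrightarrow> ?w / s\<^sup>2) (at 0)"
    by (simp add: DERIV_def)
  moreover have "filterlim h (at 0) sequentially"
    using h by (auto simp: filterlim_at)
  ultimately have "(\<lambda>n. (exp ((h n * ?w - (h n)\<^sup>2 / 2) / s\<^sup>2) - 1) / h n) \<longlonglongrightarrow> ?w / s\<^sup>2"
    by (rule filterlim_compose)
  then have "(\<lambda>n. isotropic_normal_density m s z * ((exp ((h n * ?w - (h n)\<^sup>2 / 2) / s\<^sup>2) - 1) / h n))
      \<longlonglongrightarrow> isotropic_normal_density m s z * (?w / s\<^sup>2)"
    by (rule tendsto_mult_left)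
  then show ?thesis
    unfolding isotropic_normal_density_translate[OF assms(1)]
    by (simp add: right_diff_distrib)
qed

lemma abs_exp_diff_one_le: "\<bar>exp x - 1\<bar> \<le> \<bar>x\<bar> * exp \<bar>x\<bar>" for x :: real
proof (cases "x \<ge> 0")
  case True
  have "exp x * (1 - x) \<le> exp x * exp (- x)"
    using exp_ge_add_one_self[of "- x"] by (intro mult_left_mono) auto
  then show ?thesis using True by (simp add: algebra_simps flip: exp_add)
next
  case False
  then have "1 - exp x \<le> - x" using exp_ge_add_one_self[of x] by linarith
  also have "\<dots> \<le> - x * exp (- x)" using False by (intro mult_le_cancel_left1[THEN iffD2]) auto
  finally show ?thesis using False by simp
qed

text \<open>The bound is uniform in the step and will serve in dominated convergence. For steps of
  size at most 1 the exponential factor grows at most like \<open>exp ((1 + u) / s\<^sup>2)\<close>,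
  which half of the Gaussian decay absorbs.\<close>

lemma isotropic_normal_density_difference_quotient_bound:
  fixes m :: "real^'n"
  assumes "s \<noteq> 0"
  obtains K where "K \<ge> 0" "\<And>z t i. t \<noteq> 0 \<Longrightarrow> \<bar>t\<bar> \<le> 1 \<Longrightarrow>
    \<bar>(isotropic_normal_density m s (z - t *\<^sub>R axis i 1) - isotropic_normal_density m s z) / t\<bar>
      \<le> K * ((1 + norm (z - m)) * exp (- (1 / (4 * s\<^sup>2)) * (norm (z - m))\<^sup>2))"
proof
  let ?C = "1 / sqrt (2 * pi * s\<^sup>2) ^ CARD('n)"
  let ?K = "?C / s\<^sup>2 * exp (2 / s\<^sup>2)"
  show "?K \<ge> 0" by simp
  fix z :: "real^'n" and t :: real and i :: 'n
  assume t: "t \<noteq> 0" "\<bar>t\<bar> \<le> 1"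
  define w where "w = z $ i - m $ i"
  define u where "u = norm (z - m)"
  have w: "\<bar>w\<bar> \<le> u" using component_le_norm_cart[of "z - m" i] by (simp add: w_def u_def)
  then have u: "u \<ge> 0" by simp
  define x where "x = (t * w - t\<^sup>2 / 2) / s\<^sup>2"
  have s: "s\<^sup>2 > 0" using assms by simp
  have "\<bar>t * w - t\<^sup>2 / 2\<bar> \<le> \<bar>t\<bar> * \<bar>w\<bar> + \<bar>t\<bar> * \<bar>t\<bar> / 2"
    by (rule order_trans[OF abs_triangle_ineq4]) (simp add: abs_mult power2_eq_square)
  also have "\<dots> \<le> \<bar>t\<bar> * (1 + u)"
    using mult_left_mono[OF w, of "\<bar>t\<bar>"] mult_left_mono[OF t(2), of "\<bar>t\<bar>"] by (simp add: distrib_left)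
  finally have "\<bar>t * w - t\<^sup>2 / 2\<bar> \<le> \<bar>t\<bar> * (1 + u)" .
  then have x: "\<bar>x\<bar> \<le> \<bar>t\<bar> * ((1 + u) / s\<^sup>2)"
    using s by (simp add: x_def abs_divide divide_right_mono)
  also have "\<dots> \<le> 1 * ((1 + u) / s\<^sup>2)" using t(2) u by (intro mult_right_mono) auto
  finally have x1: "\<bar>x\<bar> \<le> (1 + u) / s\<^sup>2" by simp
  have "\<bar>exp x - 1\<bar> \<le> \<bar>x\<bar> * exp \<bar>x\<bar>" by (rule abs_exp_diff_one_le)
  also have "\<dots> \<le> (\<bar>t\<bar> * ((1 + u) / s\<^sup>2)) * exp ((1 + u) / s\<^sup>2)"
    using x x1 u by (intro mult_mono) auto
  finally have e: "\<bar>(exp x - 1) / t\<bar> \<le> (1 + u) / s\<^sup>2 * exp ((1 + u) / s\<^sup>2)"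
    using t(1) by (simp add: abs_divide divide_le_eq mult_ac)
  \<comment> \<open>Completing the square trades the linear term for half of the quadratic one; the
    remaining 2 produces the factor \<open>exp (2 / s\<^sup>2)\<close> of \<open>?K\<close>.\<close>
  have "1 + u - u\<^sup>2 / 2 \<le> 2 - u\<^sup>2 / 4"
    using zero_le_power2[of "u / 2 - 1"] by (simp add: power2_eq_square field_simps)
  then have "(1 + u - u\<^sup>2 / 2) / s\<^sup>2 \<le> (2 - u\<^sup>2 / 4) / s\<^sup>2"
    using s by (intro divide_right_mono) auto
  then have le: "- u\<^sup>2 / (2 * s\<^sup>2) + (1 + u) / s\<^sup>2 \<le> 2 / s\<^sup>2 + - (1 / (4 * s\<^sup>2)) * u\<^sup>2"
    by (simp add: diff_divide_distrib add_divide_distrib)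
  have "(isotropic_normal_density m s (z - t *\<^sub>R axis i 1) - isotropic_normal_density m s z) / t
      = isotropic_normal_density m s z * ((exp x - 1) / t)"
    unfolding isotropic_normal_density_translate[OF assms] x_def w_def by (simp add: right_diff_distrib)
  then have "\<bar>(isotropic_normal_density m s (z - t *\<^sub>R axis i 1) - isotropic_normal_density m s z) / t\<bar>
      = ?C * exp (- u\<^sup>2 / (2 * s\<^sup>2)) * \<bar>(exp x - 1) / t\<bar>"
    by (simp only: abs_mult abs_of_nonneg[OF isotropic_normal_density_nonneg])
       (simp add: isotropic_normal_density_def u_def)
  also have "\<dots> \<le> ?C * exp (- u\<^sup>2 / (2 * s\<^sup>2)) * ((1 + u) / s\<^sup>2 * exp ((1 + u) / s\<^sup>2))"
    using e by (rule mult_left_mono) simp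
  also have "\<dots> = ?C / s\<^sup>2 * ((1 + u) * exp (- u\<^sup>2 / (2 * s\<^sup>2) + (1 + u) / s\<^sup>2))"
    by (simp only: exp_add) (simp add: mult_ac)
  also have "\<dots> \<le> ?C / s\<^sup>2 * ((1 + u) * exp (2 / s\<^sup>2 + - (1 / (4 * s\<^sup>2)) * u\<^sup>2))"
    using le u by (intro mult_left_mono) auto
  also have "\<dots> = ?K * ((1 + u) * exp (- (1 / (4 * s\<^sup>2)) * u\<^sup>2))"
    by (simp only: exp_add mult_ac)
  finally show "\<bar>(isotropic_normal_density m s (z - t *\<^sub>R axis i 1) - isotropic_normal_density m s z) / t\<bar>
      \<le> ?K * ((1 + norm (z - m)) * exp (- (1 / (4 * s\<^sup>2)) * (norm (z - m))\<^sup>2))"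
    by (simp only: u_def)
qed

section \<open>Lipschitz maps under the normal density\<close>

lemma lipschitz_linear_growth:
  fixes f :: "'a::real_normed_vector \<Rightarrow> 'b::real_normed_vector"
  assumes "L-lipschitz_on UNIV f"
  obtains K where "K \<ge> 0" "\<And>x. norm (f x) \<le> K * (1 + norm (x - m))"
proof
  have L: "L \<ge> 0" using assms by (rule lipschitz_on_nonneg)
  show "L + norm (f m) \<ge> 0" using L by simp
  fix x
  have "norm (f x - f m) \<le> L * norm (x - m)"
    using lipschitz_onD[OF assms, of x m] by (simp add: dist_norm)
  moreover have "norm (f x) \<le> norm (f x - f m) + norm (f m)" by (metis diff_add_cancel norm_triangle_ineq)
  moreover have "norm (f m) * norm (x - m) \<ge> 0" by simp
  ultimately show "norm (f x) \<le> (L + norm (f m)) * (1 + norm (x - m))"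
    using L by (simp only: distrib_left distrib_right)
qed

text \<open>Quadratic growth is what the covariance needs: it multiplies a map of linear growth by a
  coordinate.\<close>

lemma integrable_isotropic_normal_quadratic_growth:
  fixes m :: "real^'n" and g :: "real^'n \<Rightarrow> real"
  assumes "s \<noteq> 0" and [measurable]: "g \<in> borel_measurable borel" and g: "\<And>x. \<bar>g x\<bar> \<le> K * (1 + norm (x - m))\<^sup>2"
  shows "integrable lborel (\<lambda>x. isotropic_normal_density m s x * g x)"
proof (rule integrable_gaussian_bound[where c = "1 / (2 * s\<^sup>2)" and m = m
      and K = "1 / sqrt (2 * pi * s\<^sup>2) ^ CARD('n) * K"])
  fix x
  have "\<bar>isotropic_normal_density m s x * g x\<bar> \<le> isotropic_normal_density m s x * (K * (1 + norm (x - m))\<^sup>2)"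
    unfolding abs_mult abs_of_nonneg[OF isotropic_normal_density_nonneg]
    using g by (intro mult_left_mono isotropic_normal_density_nonneg)
  then show "\<bar>isotropic_normal_density m s x * g x\<bar> \<le> 1 / sqrt (2 * pi * s\<^sup>2) ^ CARD('n) * K
      * ((1 + norm (x - m))\<^sup>2 * exp (- (1 / (2 * s\<^sup>2)) * (norm (x - m))\<^sup>2))"
    by (simp add: isotropic_normal_density_def mult_ac)
qed (use assms(1) in auto)

lemma integral_lborel_translation:
  fixes g :: "'a::euclidean_space \<Rightarrow> real"
  assumes "g \<in> borel_measurable borel"
  shows "(\<integral>x. g (c + x) \<partial>lborel) = (\<integral>x. g x \<partial>lborel)"
  using assms by (subst (2) lborel_distr_plus[of c, symmetric]) (simp add: integral_distr)

lemma integrable_lborel_translation: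
  fixes g :: "'a::euclidean_space \<Rightarrow> real"
  assumes "integrable lborel g"
  shows "integrable lborel (\<lambda>x. g (c + x))"
proof -
  have "integrable (distr lborel borel ((+) c)) g" using assms by (simp add: lborel_distr_plus)
  then show ?thesis by (rule integrable_distr[rotated]) simp
qed

text \<open>\<open>D\<close> enters only as the almost everywhere limit along one sequence of steps,
  and only for the sum over the coordinates, which is the form the divergence of the lasso fit
  takes.\<close>

lemma stein_identity_lipschitz:
  fixes f :: "real^'n \<Rightarrow> real^'n" and D :: "real^'n \<Rightarrow> real"
  assumes s: "s \<noteq> 0" and lip: "L-lipschitz_on UNIV f"
    and h: "h \<longlonglongrightarrow> 0" "\<And>n. h n \<noteq> 0" "\<And>n. \<bar>h n\<bar> \<le> 1"
    and D [measurable]: "D \<in> borel_measurable borel"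
    and lim: "AE y in lborel. (\<lambda>n. \<Sum>i\<in>UNIV. (f (y + h n *\<^sub>R axis i 1) $ i - f y $ i) / h n) \<longlonglongrightarrow> D y"
  shows "(\<integral>y. isotropic_normal_density m s y * (\<Sum>i\<in>UNIV. f y $ i * (y $ i - m $ i)) \<partial>lborel)
      = s\<^sup>2 * (\<integral>y. isotropic_normal_density m s y * D y \<partial>lborel)"
proof -
  let ?p = "isotropic_normal_density m s"
  have cont: "continuous_on UNIV f" using lip by (rule lipschitz_on_continuous_on)
  then have [measurable]: "f \<in> borel_measurable borel" by (rule borel_measurable_continuous_onI)
  obtain K where K: "K \<ge> 0" "\<And>x. norm (f x) \<le> K * (1 + norm (x - m))"
    using lipschitz_linear_growth[OF lip] by metis
  obtain C where C: "C \<ge> 0" "\<And>z t i. t \<noteq> 0 \<Longrightarrow> \<bar>t\<bar> \<le> 1 \<Longrightarrow>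
      \<bar>(?p (z - t *\<^sub>R axis i 1) - ?p z) / t\<bar>
        \<le> C * ((1 + norm (z - m)) * exp (- (1 / (4 * s\<^sup>2)) * (norm (z - m))\<^sup>2))"
    using isotropic_normal_density_difference_quotient_bound[OF s] by metis
  \<comment> \<open>In \<open>a\<close> the quotient falls on the map, in \<open>b\<close> on the
    density. Their integrals agree and their limits are the two sides of the identity.\<close>
  define a where "a n y = ?p y * (\<Sum>i\<in>UNIV. (f (y + h n *\<^sub>R axis i 1) $ i - f y $ i) / h n)" for n y
  define b where "b n y = (\<Sum>i\<in>UNIV. (?p (y - h n *\<^sub>R axis i 1) - ?p y) / h n * f y $ i)" for n y
  have fi: "\<bar>f x $ i\<bar> \<le> K * (1 + norm (x - m))" for x i
    using component_le_norm_cart[of "f x" i] K(2)[of x] by linarith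
  have pf: "integrable lborel (\<lambda>y. ?p y * f y $ i)" for i
  proof (rule integrable_isotropic_normal_quadratic_growth[OF s, where K = K])
    fix x
    have "K * (1 + norm (x - m)) \<le> K * (1 + norm (x - m))\<^sup>2"
      using K(1) by (intro mult_left_mono) (auto intro: self_le_power)
    with fi show "\<bar>f x $ i\<bar> \<le> K * (1 + norm (x - m))\<^sup>2" by (rule order_trans)
  qed measurable
  have lip_i: "\<bar>f (y + t *\<^sub>R axis i 1) $ i - f y $ i\<bar> \<le> L * \<bar>t\<bar>" for y t i
    using lipschitz_onD[OF lip, of "y + t *\<^sub>R axis i 1" y]
      component_le_norm_cart[of "f (y + t *\<^sub>R axis i 1) - f y" i] by (simp add: dist_norm)
  have p1: "integrable lborel (\<lambda>y. ?p y * c)" for c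
    using integrable_isotropic_normal_quadratic_growth[OF s, of "\<lambda>_. c" "\<bar>c\<bar>" m]
    by (auto simp: mult_le_cancel_left1 one_le_power)
  have quot_le: "\<bar>(f (y + h n *\<^sub>R axis i 1) $ i - f y $ i) / h n\<bar> \<le> L" for y n i
    using lip_i[of y "h n" i] h(2)[of n] by (simp add: abs_divide divide_le_eq)
  have pshift: "integrable lborel (\<lambda>y. ?p y * f (y + t *\<^sub>R axis i 1) $ i)" for t i
  proof -
    \<comment> \<open>The shifted map differs from \<open>f\<close> by at most
      \<open>L * \<bar>t\<bar>\<close>, so integrability carries over from
      \<open>pf\<close>.\<close>
    have "integrable lborel (\<lambda>y. ?p y * (f (y + t *\<^sub>R axis i 1) $ i - f y $ i))"
    proof (rule Bochner_Integration.integrable_bound[OF p1[of "L * \<bar>t\<bar>"]])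
      show "AE y in lborel. norm (?p y * (f (y + t *\<^sub>R axis i 1) $ i - f y $ i)) \<le> norm (?p y * (L * \<bar>t\<bar>))"
        using lip_i lipschitz_on_nonneg[OF lip] by (auto simp: abs_mult isotropic_normal_density_nonneg intro!: mult_left_mono)
    qed measurable
    from Bochner_Integration.integrable_add[OF this pf[of i]] show ?thesis
      by (simp add: algebra_simps)
  qed
  have ab: "(\<integral>y. a n y \<partial>lborel) = (\<integral>y. b n y \<partial>lborel)" for n
  proof -
    \<comment> \<open>Substituting y - h e_i for y moves the shift from the map to the density with
      the opposite sign.\<close>
    have "(\<integral>y. ?p y * f (y + h n *\<^sub>R axis i 1) $ i \<partial>lborel) = (\<integral>y. ?p (y - h n *\<^sub>R axis i 1) * f y $ i \<partial>lborel)" for i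
      using integral_lborel_translation[of "\<lambda>y. ?p (y - h n *\<^sub>R axis i 1) * f y $ i" "h n *\<^sub>R axis i 1"]
      by (simp add: add.commute)
    moreover have shift: "integrable lborel (\<lambda>y. ?p (y - h n *\<^sub>R axis i 1) * f y $ i)" for i
      using integrable_lborel_translation[OF pshift[of "h n" i], of "- h n *\<^sub>R axis i 1"] by (simp add: add.commute)
    ultimately have *: "(\<integral>y. (?p y * f (y + h n *\<^sub>R axis i 1) $ i - ?p y * f y $ i) / h n \<partial>lborel)
        = (\<integral>y. (?p (y - h n *\<^sub>R axis i 1) * f y $ i - ?p y * f y $ i) / h n \<partial>lborel)" for i
      using pf pshift by (simp add: Bochner_Integration.integral_diff)
    have "(\<integral>y. a n y \<partial>lborel) = (\<integral>y. (\<Sum>i\<in>UNIV. (?p y * f (y + h n *\<^sub>R axis i 1) $ i - ?p y * f y $ i) / h n) \<partial>lborel)"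
      unfolding a_def by (simp add: sum_distrib_left right_diff_distrib)
    also have "\<dots> = (\<Sum>i\<in>UNIV. \<integral>y. (?p y * f (y + h n *\<^sub>R axis i 1) $ i - ?p y * f y $ i) / h n \<partial>lborel)"
      using pf pshift by (intro Bochner_Integration.integral_sum) auto
    also have "\<dots> = (\<integral>y. (\<Sum>i\<in>UNIV. (?p (y - h n *\<^sub>R axis i 1) * f y $ i - ?p y * f y $ i) / h n) \<partial>lborel)"
      unfolding * using pf shift by (intro Bochner_Integration.integral_sum[symmetric]) auto
    also have "\<dots> = (\<integral>y. b n y \<partial>lborel)"
      unfolding b_def by (simp add: left_diff_distrib)
    finally show ?thesis .
  qed
  have "(\<lambda>n. \<integral>y. a n y \<partial>lborel) \<longlonglongrightarrow> (\<integral>y. ?p y * D y \<partial>lborel)"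
  proof (rule integral_dominated_convergence[where w = "\<lambda>y. ?p y * (real CARD('n) * L)"])
    show "AE y in lborel. (\<lambda>n. a n y) \<longlonglongrightarrow> ?p y * D y"
      using lim unfolding a_def by eventually_elim (rule tendsto_mult_left)
    fix n
    show "AE y in lborel. norm (a n y) \<le> ?p y * (real CARD('n) * L)"
    proof (rule AE_I2)
      fix y
      have "\<bar>\<Sum>i\<in>UNIV. (f (y + h n *\<^sub>R axis i 1) $ i - f y $ i) / h n\<bar> \<le> (\<Sum>i\<in>(UNIV::'n set). L)"
        using quot_le by (intro order_trans[OF sum_abs] sum_mono)
      then show "norm (a n y) \<le> ?p y * (real CARD('n) * L)"
        by (auto simp: a_def abs_mult isotropic_normal_density_nonneg intro!: mult_left_mono)
    qed
  qed (use p1 in \<open>auto simp: a_def\<close>)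
  moreover have "(\<lambda>n. \<integral>y. b n y \<partial>lborel) \<longlonglongrightarrow> (\<integral>y. (\<Sum>i\<in>UNIV. ?p y * (y $ i - m $ i) / s\<^sup>2 * f y $ i) \<partial>lborel)"
  \<comment> \<open>Each of the coordinates contributes one linear factor from the density quotient
    and one from the growth of \<open>f\<close>, hence the square and the constant
    \<open>C * K\<close>.\<close>
  proof (rule integral_dominated_convergence[where
        w = "\<lambda>y. real CARD('n) * C * K * ((1 + norm (y - m))\<^sup>2 * exp (- (1 / (4 * s\<^sup>2)) * (norm (y - m))\<^sup>2))"])
    show "AE y in lborel. (\<lambda>n. b n y) \<longlonglongrightarrow> (\<Sum>i\<in>UNIV. ?p y * (y $ i - m $ i) / s\<^sup>2 * f y $ i)"
      unfolding b_def
      by (intro AE_I2 tendsto_sum tendsto_mult_right isotropic_normal_density_difference_quotient_tendsto s h)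
    show "integrable lborel (\<lambda>y. real CARD('n) * C * K * ((1 + norm (y - m))\<^sup>2 * exp (- (1 / (4 * s\<^sup>2)) * (norm (y - m))\<^sup>2)))"
      using s by (intro integrable_mult_right integrable_square_exp_neg_norm_square) auto
    fix n
    show "AE y in lborel. norm (b n y) \<le> real CARD('n) * C * K * ((1 + norm (y - m))\<^sup>2 * exp (- (1 / (4 * s\<^sup>2)) * (norm (y - m))\<^sup>2))"
    proof (rule AE_I2)
      fix y
      let ?E = "exp (- (1 / (4 * s\<^sup>2)) * (norm (y - m))\<^sup>2)"
      have "\<bar>(?p (y - h n *\<^sub>R axis i 1) - ?p y) / h n * f y $ i\<bar> \<le> C * ((1 + norm (y - m)) * ?E) * (K * (1 + norm (y - m)))" for i
        unfolding abs_mult using C h fi K by (intro mult_mono) auto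
      then have "norm (b n y) \<le> (\<Sum>i\<in>(UNIV::'n set). C * ((1 + norm (y - m)) * ?E) * (K * (1 + norm (y - m))))"
        unfolding b_def real_norm_def by (intro order_trans[OF sum_abs] sum_mono)
      then show "norm (b n y) \<le> real CARD('n) * C * K * ((1 + norm (y - m))\<^sup>2 * ?E)"
        by (simp add: power2_eq_square mult_ac)
    qed
  qed (auto simp: b_def)
  ultimately have "(\<integral>y. ?p y * D y \<partial>lborel) = (\<integral>y. (\<Sum>i\<in>UNIV. ?p y * (y $ i - m $ i) / s\<^sup>2 * f y $ i) \<partial>lborel)"
    unfolding ab by (rule LIMSEQ_unique)
  also have "\<dots> = (\<integral>y. ?p y * (\<Sum>i\<in>UNIV. f y $ i * (y $ i - m $ i)) / s\<^sup>2 \<partial>lborel)"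
    by (simp add: sum_distrib_left sum_divide_distrib mult_ac)
  finally show ?thesis using s by simp
qed

text \<open>This is Stein's identity for a constant map: with the i-th unit vector as value, the sum
  collapses to one coordinate and the divergence is 0.\<close>

lemma isotropic_normal_first_moment_centered:
  fixes m :: "real^'n"
  assumes "s \<noteq> 0"
  shows "(\<integral>y. isotropic_normal_density m s y * (y $ i - m $ i) \<partial>lborel) = 0"
proof -
  have "0-lipschitz_on UNIV (\<lambda>_ :: real^'n. axis i (1::real))"
    by (intro lipschitz_onI) auto
  from stein_identity_lipschitz[OF assms this, of "\<lambda>n. 1 / real (Suc n)" "\<lambda>_. 0" m]
  have "(\<integral>y. isotropic_normal_density m s y * (\<Sum>j\<in>UNIV. axis i 1 $ j * (y $ j - m $ j)) \<partial>lborel) = 0"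
    using LIMSEQ_inverse_real_of_nat by (simp add: inverse_eq_divide)
  moreover have "(\<Sum>j\<in>UNIV. axis i 1 $ j * (y $ j - m $ j)) = y $ i - m $ i" for y
    using inner_axis'[of i "1::real" "y - m"] by (simp add: inner_vec_def)
  ultimately show ?thesis by simp
qed

section \<open>Degrees of freedom\<close>

text \<open>Centring one factor suffices, because a constant times the centred \<open>V\<close> has
  expectation 0. This is the form in which Stein's identity applies.\<close>

lemma covariance_eq_centered_right:
  assumes "prob_space M" "has_covariance M U V" "prob_space.expectation M V = m"
  shows "covariance M U V = prob_space.expectation M (\<lambda>\<omega>. U \<omega> * (V \<omega> - m))"
proof -
  interpret prob_space M by fact
  have [simp]: "integrable M U" "integrable M V" "integrable M (\<lambda>\<omega>. U \<omega> * V \<omega>)"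
    using assms(2) by (auto simp: has_covariance_def)
  show ?thesis
    using assms(3) by (simp add: covariance_def algebra_simps prob_space)
qed

text \<open>All moments are carried from \<open>M\<close> to integrals against the density. The
  centred mixed moments then sum to the left side of Stein's identity, whose factor
  \<open>\<sigma>\<^sup>2\<close> cancels the one in the degrees of freedom.\<close>

lemma degrees_of_freedom_lipschitz:
  fixes f :: "real^'n \<Rightarrow> real^'n" and Y :: "'a \<Rightarrow> real^'n"
  assumes M: "prob_space M" and s: "\<sigma> \<noteq> 0"
    and Y: "distributed M lborel Y (isotropic_normal_density \<mu> \<sigma>)"
    and lip: "L-lipschitz_on UNIV f"
    and h: "h \<longlonglongrightarrow> 0" "\<And>n. h n \<noteq> 0" "\<And>n. \<bar>h n\<bar> \<le> 1"
    and D [measurable]: "D \<in> borel_measurable borel"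
    and lim: "AE y in lborel. (\<lambda>n. \<Sum>i\<in>UNIV. (f (y + h n *\<^sub>R axis i 1) $ i - f y $ i) / h n) \<longlonglongrightarrow> D y"
  shows "has_covariance M (\<lambda>\<omega>. f (Y \<omega>) $ i) (\<lambda>\<omega>. Y \<omega> $ i)"
    and "degrees_of_freedom M Y \<sigma> f = prob_space.expectation M (\<lambda>\<omega>. D (Y \<omega>))"
proof -
  interpret prob_space M by fact
  have "continuous_on UNIV f" using lip by (rule lipschitz_on_continuous_on)
  then have [measurable]: "f \<in> borel_measurable borel" by (rule borel_measurable_continuous_onI)
  obtain K where K: "K \<ge> 0" "\<And>x. norm (f x) \<le> K * (1 + norm (x - \<mu>))"
    using lipschitz_linear_growth[OF lip] by metis
  have fi: "\<bar>f y $ i\<bar> \<le> K * (1 + norm (y - \<mu>))" for y i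
    using component_le_norm_cart[of "f y" i] K(2)[of y] by linarith
  have ci: "\<bar>y $ i - \<mu> $ i\<bar> \<le> norm (y - \<mu>)" for y i
    using component_le_norm_cart[of "y - \<mu>" i] by simp
  have growth1: "c * (1 + norm (y - \<mu>)) \<le> c * (1 + norm (y - \<mu>))\<^sup>2" if "c \<ge> 0" for c y
    using that by (intro mult_left_mono self_le_power) auto
  have int: "integrable M (\<lambda>\<omega>. g (Y \<omega>))"
    if "g \<in> borel_measurable borel" "\<And>y. \<bar>g y\<bar> \<le> c * (1 + norm (y - \<mu>))\<^sup>2" for g c
    using integrable_isotropic_normal_quadratic_growth[OF s that] distributed_integrable[OF Y] that(1)
    by (simp add: isotropic_normal_density_nonneg)
  have E: "expectation (\<lambda>\<omega>. g (Y \<omega>)) = (\<integral>y. isotropic_normal_density \<mu> \<sigma> y * g y \<partial>lborel)"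
    if "g \<in> borel_measurable borel" for g
    using distributed_integral[OF Y, of g] that by (simp add: isotropic_normal_density_nonneg)
  have f_int: "integrable M (\<lambda>\<omega>. f (Y \<omega>) $ i)" for i
    using order_trans[OF fi growth1[OF K(1)]] by (intro int[of "\<lambda>y. f y $ i" K]) auto
  have d_int: "integrable M (\<lambda>\<omega>. Y \<omega> $ i - \<mu> $ i)" for i
  proof (rule int[of "\<lambda>y. y $ i - \<mu> $ i" 1])
    show "\<bar>y $ i - \<mu> $ i\<bar> \<le> 1 * (1 + norm (y - \<mu>))\<^sup>2" for y
      using ci[of y i] growth1[of 1 y] by simp
  qed measurable
  have fd_int: "integrable M (\<lambda>\<omega>. f (Y \<omega>) $ i * (Y \<omega> $ i - \<mu> $ i))" for i
  proof (rule int[of "\<lambda>y. f y $ i * (y $ i - \<mu> $ i)" K])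
    fix y
    have "\<bar>f y $ i * (y $ i - \<mu> $ i)\<bar> \<le> K * (1 + norm (y - \<mu>)) * (1 + norm (y - \<mu>))"
      unfolding abs_mult using fi ci[of y i] K(1) by (intro mult_mono) auto
    then show "\<bar>f y $ i * (y $ i - \<mu> $ i)\<bar> \<le> K * (1 + norm (y - \<mu>))\<^sup>2"
      by (simp add: power2_eq_square mult.assoc)
  qed measurable
  have Y_int: "integrable M (\<lambda>\<omega>. Y \<omega> $ i)" for i
    using Bochner_Integration.integrable_add[OF d_int[of i], of "\<lambda>_. \<mu> $ i"] by simp
  \<comment> \<open>The uncentred product is the centred one plus a multiple of the integrable
    component of the fit.\<close>
  have cov: "has_covariance M (\<lambda>\<omega>. f (Y \<omega>) $ i) (\<lambda>\<omega>. Y \<omega> $ i)" for i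
    using f_int[of i] Y_int[of i]
      Bochner_Integration.integrable_add[OF fd_int[of i] Bochner_Integration.integrable_mult_left[OF f_int[of i], of "\<mu> $ i"]]
    by (simp add: has_covariance_def algebra_simps)
  show "has_covariance M (\<lambda>\<omega>. f (Y \<omega>) $ i) (\<lambda>\<omega>. Y \<omega> $ i)" by (rule cov)
  have "expectation (\<lambda>\<omega>. Y \<omega> $ i - \<mu> $ i) = 0" for i
    using isotropic_normal_first_moment_centered[OF s, of \<mu> i] by (subst E[of "\<lambda>y. y $ i - \<mu> $ i"]) auto
  then have "expectation (\<lambda>\<omega>. Y \<omega> $ i) = \<mu> $ i" for i
    using Y_int by (simp add: prob_space)
  then have "covariance M (\<lambda>\<omega>. f (Y \<omega>) $ i) (\<lambda>\<omega>. Y \<omega> $ i)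
      = expectation (\<lambda>\<omega>. f (Y \<omega>) $ i * (Y \<omega> $ i - \<mu> $ i))" for i
    by (intro covariance_eq_centered_right M cov)
  then have "degrees_of_freedom M Y \<sigma> f
      = (\<Sum>i\<in>UNIV. expectation (\<lambda>\<omega>. f (Y \<omega>) $ i * (Y \<omega> $ i - \<mu> $ i))) / \<sigma>\<^sup>2"
    by (simp add: degrees_of_freedom_def sum_divide_distrib)
  also have "\<dots> = expectation (\<lambda>\<omega>. \<Sum>i\<in>UNIV. f (Y \<omega>) $ i * (Y \<omega> $ i - \<mu> $ i)) / \<sigma>\<^sup>2"
    using fd_int by (subst Bochner_Integration.integral_sum) auto
  also have "\<dots> = (\<integral>y. isotropic_normal_density \<mu> \<sigma> y * (\<Sum>i\<in>UNIV. f y $ i * (y $ i - \<mu> $ i)) \<partial>lborel) / \<sigma>\<^sup>2"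
    by (subst E) auto
  also have "\<dots> = (\<integral>y. isotropic_normal_density \<mu> \<sigma> y * D y \<partial>lborel)"
    using s by (subst stein_identity_lipschitz[OF s lip h D lim]) simp
  also have "\<dots> = expectation (\<lambda>\<omega>. D (Y \<omega>))" by (simp add: E)
  finally show "degrees_of_freedom M Y \<sigma> f = expectation (\<lambda>\<omega>. D (Y \<omega>))" .
qed

text \<open>The count is a finite sum of indicators of nonzero coordinates, and the coordinates are
  continuous in the response.\<close>

lemma card_active_set_measurable:
  fixes X :: "real^'p^'n"
  assumes "inj ((*v) X)" "lam \<ge> 0"
  shows "(\<lambda>y. real (card (active_set X lam y))) \<in> borel_measurable borel"
proof -
  have [measurable]: "lasso X lam \<in> borel_measurable borel"
    using lasso_continuous[OF assms] by (rule borel_measurable_continuous_onI)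
  have "real (card (active_set X lam y)) = (\<Sum>j\<in>UNIV. if lasso X lam y $ j = 0 then 0 else 1)" for y
    by (simp add: active_set_def sum.If_cases Collect_neg_eq)
  then show ?thesis by simp
qed

text \<open>The conjuncts on covariance and integrability rule out the default value 0 of a Bochner
  integral, so the last equation compares genuine moments.\<close>

theorem theorem1:
  fixes X :: "real^'p^'n" and lam :: real
  assumes "rank X = CARD('p)" and "lam \<ge> 0"
  shows "(\<exists>L. L-lipschitz_on UNIV (lasso_fit X lam)) \<and>
    (\<forall>(M :: 'a measure) (Y :: 'a \<Rightarrow> real^'n) \<mu> \<sigma>.
       prob_space M \<longrightarrow> \<sigma>\<^sup>2 > 0 \<longrightarrow>
       distributed M lborel Y (isotropic_normal_density \<mu> \<sigma>) \<longrightarrow>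
         (\<forall>i. has_covariance M (\<lambda>\<omega>. lasso_fit X lam (Y \<omega>) $ i) (\<lambda>\<omega>. Y \<omega> $ i)) \<and>
         integrable M (\<lambda>\<omega>. real (card (active_set X lam (Y \<omega>)))) \<and>
         degrees_of_freedom M Y \<sigma> (lasso_fit X lam) =
           prob_space.expectation M (\<lambda>\<omega>. real (card (active_set X lam (Y \<omega>)))))"
proof (intro conjI allI impI)
  have inj: "inj ((*v) X)" using assms(1) full_rank_injective by blast
  note lip = lasso_fit_lipschitz[OF inj assms(2)]
  then show "\<exists>L. L-lipschitz_on UNIV (lasso_fit X lam)" by blast
  note D = card_active_set_measurable[OF inj assms(2)]
  fix M :: "'a measure" and Y :: "'a \<Rightarrow> real^'n" and \<mu> \<sigma>
  assume M: "prob_space M" and s2: "\<sigma>\<^sup>2 > 0"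
    and Y: "distributed M lborel Y (isotropic_normal_density \<mu> \<sigma>)"
  interpret prob_space M by fact
  have s: "\<sigma> \<noteq> 0" using s2 by auto
  \<comment> \<open>Any null sequence of nonzero steps of modulus at most 1 would serve.\<close>
  have h: "(\<lambda>n. inverse (real (Suc n))) \<longlonglongrightarrow> 0" "\<And>n. inverse (real (Suc n)) \<noteq> 0"
      "\<And>n. \<bar>inverse (real (Suc n))\<bar> \<le> 1"
    using LIMSEQ_inverse_real_of_nat by (auto simp: divide_simps)
  note dof = degrees_of_freedom_lipschitz[OF M s Y lip h D AE_lasso_divergence[OF inj assms(2) h(1,2)]]
  show "has_covariance M (\<lambda>\<omega>. lasso_fit X lam (Y \<omega>) $ i) (\<lambda>\<omega>. Y \<omega> $ i)" for i by (rule dof(1))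
  show "degrees_of_freedom M Y \<sigma> (lasso_fit X lam) = expectation (\<lambda>\<omega>. real (card (active_set X lam (Y \<omega>))))"
    by (rule dof(2))
  show "integrable M (\<lambda>\<omega>. real (card (active_set X lam (Y \<omega>))))"
  proof (rule integrable_const_bound[where B = "real CARD('p)"])
    have [measurable]: "Y \<in> borel_measurable M" using distributed_measurable[OF Y] by simp
    show "(\<lambda>\<omega>. real (card (active_set X lam (Y \<omega>)))) \<in> borel_measurable M"
      using measurable_compose[OF _ D, of Y] by simp
  qed (auto intro!: AE_I2 card_mono)
qed

end
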